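(* Let $\mathbb{F}=\mathbb{R}$ or $\mathbb{C}$, and let $T:\mathbb{F}^n\to\mathbb{F}^n$ be an $\mathbb{F}$-linear transformation. (i) If $\mathbb{F}=\mathbb{R}$, then $T$ scales $n$-dimensional volumes in $\mathbb{R}^n$ by a factor of $|\det T|$. (ii) If $\mathbb{F}=\mathbb{C}$, then $T$ scales $2n$-dimensional volumes in $(\mathbb{C}^n)_{\mathbb{R}}$ by a factor of $|\det T|^2$.
   Context: $(\mathbb{C}^n)_{\mathbb{R}}=\mathbb{R}^{2n}$ is the underlying real space of $\mathbb{C}^n$, with $(x_1+\mathrm{i}y_1,\ldots,x_n+\mathrm{i}y_n)$ identified with $(x_1,y_1,\ldots,x_n,y_n)$ and with inner product the real part of the canonical Hermitian product. In (ii), $\det T$ is the determinant of $T$ as a $\mathbb{C}$-linear map. "$T$ scales $k$-volumes by a factor $c$" means that the $k$-dimensional volume of $T(E)$ is $c$ times that of $E$, for measurable sets $E$ (with the convention $0\cdot\infty=0$). *)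

theory Defs
  imports "HOL-Analysis.Analysis"
begin

text \<open>
  Volume is Lebesgue measure on the Euclidean space \<^typ>\<open>'a\<close>, of dimension
  \<open>DIM('a)\<close>. Measurable sets are Lebesgue (not Borel) measurable, since a singular linear map may
  send a Borel set to a non-Borel null set. The product is taken in \<^typ>\<open>ennreal\<close>, where
  \<open>0 * \<infinity> = 0\<close>.
\<close>

definition scales_volumes :: "('a::euclidean_space \<Rightarrow> 'a) \<Rightarrow> real \<Rightarrow> bool" where
  "scales_volumes T c \<longleftrightarrow>
     (\<forall>E \<in> sets lebesgue. T ` E \<in> sets lebesgue \<and>
        emeasure lebesgue (T ` E) = ennreal c * emeasure lebesgue E)"

text \<open>
  The library's Euclidean structure on \<open>complex ^ 'n\<close> is that of the underlying real space:
  its inner product is the real part of the Hermitian product, its dimension is \<open>2 * CARD('n)\<close>,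
  and its orthonormal basis consists of the real and imaginary coordinate vectors.
\<close>

lemma inner_complex_vec_eq_Re_hermitian:
  fixes z w :: "complex ^ 'n"
  shows "z \<bullet> w = Re (\<Sum>i\<in>UNIV. z $ i * cnj (w $ i))"
  by (simp add: inner_vec_def inner_complex_def)

lemma DIM_complex_vec: "DIM(complex ^ 'n) = 2 * CARD('n)"
  by simp

lemma Basis_complex_vec:
  "(Basis :: (complex ^ 'n) set) = (\<Union>i. {axis i 1, axis i \<i>})"
  by (auto simp: Basis_vec_def Basis_complex_def)

end

theory Submission
  imports Defs
begin

text \<open>
  The real and the complex case are one statement: over a field \<open>'f\<close> that is also a Euclidean space
  of real dimension \<open>d\<close> and whose norm is multiplicative, an \<open>'f\<close>-linear map scales volumes by
  \<open>norm (det T) ^ d\<close>; here \<open>d = 1\<close> for \<open>\<real>\<close> and \<open>d = 2\<close> for \<open>\<complex>\<close>.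

  A singular map has a proper subspace as its image, so it sends everything to null sets. For an
  invertible map, \<open>E \<mapsto> vol (T E)\<close> is again a translation invariant measure, hence a
  multiple of Lebesgue measure (\<open>translation_invariant_measure_eq_scaled_lborel\<close>). So some factor
  exists before anything is computed (\<open>linear_inj_scales_volumes\<close>), and it is multiplicative
  in \<open>T\<close>.

  Since \<open>norm (det T) ^ d\<close> is multiplicative too, it is enough to compare the two on generators of
  the invertible matrices. Identity matrices with one row replaced by a vector \<open>v\<close> suffice
  (\<open>invertible_matrix_induct_id_with_row\<close>). If that row is a multiple \<open>a\<close> of the unit row, then the
  map multiplies one coordinate by \<open>a\<close>, which is an isometry followed by a stretch of \<open>d\<close> real
  coordinates. The general row reduces to this one without
  computing the volume of a sheared set: if the diagonal entry is not 1, the matrix is conjugate to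
  a coordinate dilatation, and factors do not change under conjugation; if it is 1, multiplying by
  a dilatation by 2 leads back to the previous case.
\<close>

section \<open>Uniqueness of Lebesgue measure\<close>

text \<open>
  Both sides are evaluations of \<open>\<integral>\<integral> 1\<^sub>E(x) 1\<^sub>Q(y) dM(x) dy\<close>. Translating \<open>x\<close> by \<open>y\<close> and then,
  after exchanging the integrals, \<open>y\<close> by \<open>-x\<close> turns the integrand into \<open>1\<^sub>E(y) 1\<^sub>Q(y - x)\<close>. By the
  symmetry of \<open>Q\<close>, integrating over \<open>x\<close> now gives the constant \<open>M(Q)\<close>, which leaves the volume
  of \<open>E\<close>.
\<close>
lemma translation_invariant_measure_eq_scaled_lborel:
  fixes M :: "'a::euclidean_space measure"
  assumes sets: "sets M = sets borel"
    and "sigma_finite_measure M"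
    and inv: "\<And>y. distr M borel ((+) y) = M"
    and E: "E \<in> sets borel"
    and Q: "Q \<in> sets borel" "\<And>x. - x \<in> Q \<longleftrightarrow> x \<in> Q"
  shows "emeasure M E * emeasure lborel Q = emeasure M Q * emeasure lborel E"
proof -
  interpret M: sigma_finite_measure M by fact
  interpret P: pair_sigma_finite M "lborel :: 'a measure"
    by unfold_locales
  interpret P': pair_sigma_finite "lborel :: 'a measure" M
    by unfold_locales
  let ?e = "indicator E :: 'a \<Rightarrow> ennreal" and ?q = "indicator Q :: 'a \<Rightarrow> ennreal"
  note [measurable_cong] = sets
  have [measurable]: "E \<in> sets borel" "Q \<in> sets borel" by fact+
  have shift_M: "(\<integral>\<^sup>+ x. f (y + x) \<partial>M) = (\<integral>\<^sup>+ x. f x \<partial>M)"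
    if [measurable]: "f \<in> borel_measurable borel" for f :: "'a \<Rightarrow> ennreal" and y
    by (subst (2) inv[symmetric, of y], subst nn_integral_distr) simp_all
  have shift_lborel: "(\<integral>\<^sup>+ x. f (y + x) \<partial>lborel) = (\<integral>\<^sup>+ x. f x \<partial>lborel)"
    if [measurable]: "f \<in> borel_measurable borel" for f :: "'a \<Rightarrow> ennreal" and y
    by (subst (2) lborel_distr_plus[symmetric, of y], subst nn_integral_distr) simp_all
  have q: "?q (y - (y + x)) = ?q x" for x y
    by (simp add: indicator_def Q(2))
  have "emeasure M E * emeasure lborel Q = (\<integral>\<^sup>+ y. (\<integral>\<^sup>+ x. ?e x * ?q y \<partial>M) \<partial>lborel)"
    by (simp add: nn_integral_multc nn_integral_cmult_indicator sets)
  also have "\<dots> = (\<integral>\<^sup>+ y. (\<integral>\<^sup>+ x. ?e (x + y) * ?q y \<partial>M) \<partial>lborel)"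
    using shift_M[of "\<lambda>x. ?e x * ?q y" y for y] by (simp add: add.commute)
  also have "\<dots> = (\<integral>\<^sup>+ x. (\<integral>\<^sup>+ y. ?e (x + y) * ?q y \<partial>lborel) \<partial>M)"
    by (rule P.Fubini') measurable
  also have "\<dots> = (\<integral>\<^sup>+ x. (\<integral>\<^sup>+ y. ?e y * ?q (y - x) \<partial>lborel) \<partial>M)"
    using shift_lborel[of "\<lambda>y. ?e y * ?q (y - x)" x for x] by simp
  also have "\<dots> = (\<integral>\<^sup>+ y. (\<integral>\<^sup>+ x. ?e y * ?q (y - x) \<partial>M) \<partial>lborel)"
    by (rule P'.Fubini') measurable
  also have "\<dots> = (\<integral>\<^sup>+ y. (\<integral>\<^sup>+ x. ?e y * ?q x \<partial>M) \<partial>lborel)"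
    using shift_M[of "\<lambda>x. ?e y * ?q (y - x)" y for y] by (simp only: q) simp
  also have "\<dots> = emeasure M Q * emeasure lborel E"
    by (simp add: nn_integral_cmult nn_integral_multc sets mult.commute)
  finally show ?thesis .
qed

section \<open>The volume factor of a linear map\<close>

text \<open>
  Any set of finite positive volume would determine the factor of a map that scales volumes. The
  unit ball is convenient because it is symmetric and invariant under norm-preserving maps.
\<close>
definition volume_factor :: "('a::euclidean_space \<Rightarrow> 'a) \<Rightarrow> real" where
  "volume_factor T = measure lebesgue (T ` ball 0 1) / measure lebesgue (ball (0::'a) 1)"

lemma volume_factor_unique:
  fixes T :: "'a::euclidean_space \<Rightarrow> 'a"
  assumes "scales_volumes T c" "c \<ge> 0"
  shows "volume_factor T = c"
proof -
  have "measure lebesgue (T ` ball 0 1) = c * measure lebesgue (ball (0::'a) 1)"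
    using assms by (simp add: scales_volumes_def measure_def enn2real_mult del: emeasure_completion)
  moreover have "measure lebesgue (ball (0::'a) 1) > 0"
    by (simp add: content_ball_pos)
  ultimately show ?thesis
    by (simp add: volume_factor_def)
qed

lemma scales_volumes_compose:
  fixes S T :: "'a::euclidean_space \<Rightarrow> 'a"
  assumes "scales_volumes S a" "scales_volumes T b" "a \<ge> 0" "b \<ge> 0"
  shows "scales_volumes (S \<circ> T) (a * b)"
  unfolding scales_volumes_def
proof (intro ballI conjI)
  fix E :: "'a set" assume E: "E \<in> sets lebesgue"
  have S: "S ` F \<in> sets lebesgue" "emeasure lebesgue (S ` F) = ennreal a * emeasure lebesgue F"
    and T: "T ` F \<in> sets lebesgue" "emeasure lebesgue (T ` F) = ennreal b * emeasure lebesgue F"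
    if "F \<in> sets lebesgue" for F
    using assms that unfolding scales_volumes_def by blast+
  show "(S \<circ> T) ` E \<in> sets lebesgue"
    unfolding image_comp[symmetric] by (intro S T E)
  show "emeasure lebesgue ((S \<circ> T) ` E) = ennreal (a * b) * emeasure lebesgue E"
    unfolding image_comp[symmetric] S(2)[OF T(1)[OF E]] T(2)[OF E] ennreal_mult[OF assms(3,4)]
    by (rule mult.assoc[symmetric])
qed

text \<open>
  A Lebesgue set is the union of a Borel set and a null set, and linear maps, being differentiable,
  send null sets to null sets.
\<close>
lemma scales_volumes_if_borel:
  fixes T :: "'a::euclidean_space \<Rightarrow> 'a"
  assumes "linear T"
    and borel: "\<And>B. B \<in> sets borel \<Longrightarrow> emeasure lebesgue (T ` B) = ennreal c * emeasure lebesgue B"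
  shows "scales_volumes T c"
  unfolding scales_volumes_def
proof (intro ballI conjI)
  fix E :: "'a set" assume E: "E \<in> sets lebesgue"
  have diff: "T differentiable_on S" for S
    using assms(1) by (rule linear_imp_differentiable_on)
  show "T ` E \<in> sets lebesgue"
    by (rule differentiable_image_in_sets_lebesgue[OF E _ diff]) simp
  obtain B N where BN: "B \<in> sets borel" "negligible N" "B \<union> N = E"
    using sets_lebesgue_almost_borel[OF E] .
  have "negligible (T ` N)"
    by (rule negligible_differentiable_image_negligible[OF _ BN(2) diff]) simp
  then have N: "N \<in> null_sets lebesgue" "T ` N \<in> null_sets lebesgue"
    using BN(2) by (auto simp: negligible_iff_null_sets)
  have TB: "T ` B \<in> sets lebesgue"
    by (rule differentiable_image_in_sets_lebesgue[OF _ _ diff]) (use BN(1) in auto)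
  have "emeasure lebesgue (T ` E) = emeasure lebesgue (T ` B \<union> T ` N)"
    using BN(3) by (auto simp: image_Un)
  also have "\<dots> = emeasure lebesgue (T ` B)"
    by (rule emeasure_Un_null_set[OF TB N(2)])
  also have "\<dots> = ennreal c * emeasure lebesgue (B \<union> N)"
    using BN(1) N(1) by (subst emeasure_Un_null_set) (auto simp: borel)
  finally show "emeasure lebesgue (T ` E) = ennreal c * emeasure lebesgue E"
    using BN(3) by simp
qed

text \<open>
  The measure \<open>M\<close> with \<open>M(B) = vol (T B)\<close> is the image of Lebesgue measure under the inverse of \<open>T\<close>;
  it is translation invariant because shifting \<open>B\<close> by \<open>y\<close> shifts \<open>T B\<close> by \<open>T y\<close>. Comparing it with
  Lebesgue measure on the unit ball gives the constant, which is positive since \<open>T\<close> sends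
  the ball to a nonempty open set.
\<close>
proposition linear_inj_scales_volumes:
  fixes T :: "'a::euclidean_space \<Rightarrow> 'a"
  assumes T: "linear T" and "inj T"
  shows "scales_volumes T (volume_factor T)" "volume_factor T > 0"
proof -
  obtain S where S: "linear S" "S \<circ> T = id" "T \<circ> S = id"
    using linear_injective_isomorphism[OF assms] by (auto simp: fun_eq_iff)
  then have ST: "S (T x) = x" "T (S x) = x" for x
    by (auto simp: fun_eq_iff)
  have [measurable]: "S \<in> borel_measurable borel"
    using S(1) by (intro borel_measurable_continuous_onI linear_continuous_on)
                  (simp add: linear_conv_bounded_linear)
  have TB: "T ` B = S -` B" for B
    by (auto simp: image_iff ST) (metis ST(2))
  define M where "M = distr lborel borel S"
  have M: "emeasure M B = emeasure lborel (T ` B)" if "B \<in> sets borel" for B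
    using that by (simp add: M_def emeasure_distr TB)
  have TB_borel: "T ` B \<in> sets borel" if "B \<in> sets borel" for B
    using measurable_sets[OF \<open>S \<in> borel_measurable borel\<close> that] by (simp add: TB)
  have "surj T"
    using ST(2) by (metis surjI)
  then have opn: "open (T ` ball 0 r)" for r
    using T by (intro open_surjective_linear_image) auto
  have bdd: "bounded (T ` ball 0 r)" for r
    using T by (intro bounded_linear_image) (auto simp: linear_conv_bounded_linear)
  have fin: "emeasure M (ball 0 r) < \<infinity>" for r
    using emeasure_bounded_finite[OF bdd] by (simp add: M)
  have sf: "sigma_finite_measure M"
  proof
    show "\<exists>A. countable A \<and> A \<subseteq> sets M \<and> \<Union>A = space M \<and> (\<forall>a\<in>A. emeasure M a \<noteq> \<infinity>)"
      using fin
      by (intro exI[of _ "range (\<lambda>n. ball 0 (real n))"])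
         (auto simp: M_def less_top[symmetric] intro: reals_Archimedean2)
  qed
  have inv: "distr M borel ((+) y) = M" for y
  proof -
    have "distr M borel ((+) y) = distr lborel borel ((+) y \<circ> S)"
      unfolding M_def by (rule distr_distr) simp_all
    also have "(+) y \<circ> S = S \<circ> (+) (T y)"
      using ST by (auto simp: fun_eq_iff linear_add[OF S(1)])
    also have "distr lborel borel (S \<circ> (+) (T y)) = distr (distr lborel borel ((+) (T y))) borel S"
      by (rule distr_distr[symmetric]) simp_all
    finally show ?thesis
      by (simp add: M_def lborel_distr_plus)
  qed
  let ?Q = "ball (0::'a) 1"
  have pos: "measure lebesgue ?Q > 0"
    by (simp add: content_ball_pos)
  have TQ: "emeasure lebesgue (T ` ?Q) = ennreal (measure lebesgue (T ` ?Q))"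
    using fin[of 1] TB_borel[of ?Q]
    by (intro emeasure_eq_ennreal_measure) (simp add: M)
  have Q: "emeasure lebesgue ?Q = ennreal (measure lebesgue ?Q)"
    using emeasure_lborel_ball_finite[of "0::'a" 1]
    by (intro emeasure_eq_ennreal_measure) (simp add: less_top)
  show "scales_volumes T (volume_factor T)"
  proof (rule scales_volumes_if_borel[OF T])
    fix B :: "'a set" assume B: "B \<in> sets borel"
    have "emeasure lebesgue (T ` B) * emeasure lebesgue ?Q =
          emeasure lebesgue (T ` ?Q) * emeasure lebesgue B"
      using translation_invariant_measure_eq_scaled_lborel[OF _ sf inv B, of ?Q] B TB_borel
      by (simp add: M_def) (simp add: M flip: M_def)
    also have "emeasure lebesgue (T ` ?Q) =
          ennreal (volume_factor T) * emeasure lebesgue ?Q"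
      using pos unfolding TQ Q volume_factor_def
      by (subst ennreal_mult[symmetric]) auto
    finally have "emeasure lebesgue ?Q * emeasure lebesgue (T ` B) =
        emeasure lebesgue ?Q * (ennreal (volume_factor T) * emeasure lebesgue B)"
      by (simp add: ac_simps)
    then show "emeasure lebesgue (T ` B) = ennreal (volume_factor T) * emeasure lebesgue B"
      using pos by (subst (asm) ennreal_mult_cancel_left) (simp add: Q)
  qed
  have "measure lebesgue (T ` ?Q) > 0"
    using opn[of 1] bdd[of 1] open_not_negligible[of "T ` ?Q"]
    by (metis ball_eq_empty image_is_empty bounded_set_imp_lmeasurable lmeasurable_open
          negligible_iff_measure0 not_one_le_zero zero_less_measure_iff)
  then show "volume_factor T > 0"
    using pos by (simp add: volume_factor_def)
qed

lemma volume_factor_compose: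
  fixes S T :: "'a::euclidean_space \<Rightarrow> 'a"
  assumes "linear S" "inj S" "linear T" "inj T"
  shows "volume_factor (S \<circ> T) = volume_factor S * volume_factor T"
  by (intro volume_factor_unique scales_volumes_compose linear_inj_scales_volumes mult_nonneg_nonneg)
     (simp_all add: assms linear_inj_scales_volumes less_imp_le)

lemma volume_factor_norm_preserving:
  assumes "surj T" "\<And>x. norm (T x) = norm x"
  shows "volume_factor T = 1"
proof -
  have "T ` ball 0 1 = ball 0 1"
    using assms by (auto simp: image_iff surj_def) (metis mem_ball_0)
  then show ?thesis
    using content_ball_pos[of 1 "0::'a"] by (simp add: volume_factor_def)
qed

text \<open>
  This is the one place where volumes are computed: a diagonal change of coordinates multiplies the
  volume of a box by the product of its entries.
\<close>
lemma volume_factor_stretch: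
  fixes c :: "'a::euclidean_space \<Rightarrow> real"
  assumes c: "\<And>b. b \<in> Basis \<Longrightarrow> c b \<noteq> 0"
  shows "volume_factor (\<lambda>x. \<Sum>b\<in>Basis. (c b * (x \<bullet> b)) *\<^sub>R b) = (\<Prod>b\<in>Basis. \<bar>c b\<bar>)"
    (is "volume_factor ?T = ?p")
proof -
  have lin: "linear ?T"
    by (auto intro!: linearI simp: inner_simps algebra_simps sum.distrib scaleR_sum_right)
  have "inj ?T"
  proof (rule injI, rule euclidean_eqI)
    fix x y b :: 'a assume "?T x = ?T y" and b: "b \<in> Basis"
    then have "?T x \<bullet> b = ?T y \<bullet> b" by simp
    then show "x \<bullet> b = y \<bullet> b"
      using b c[OF b] by simp
  qed
  have T: "?T \<in> borel_measurable borel"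
    by simp
  let ?Q = "ball (0::'a) 1"
  have "surj ?T"
    using linear_injective_imp_surjective lin \<open>inj ?T\<close> by blast
  then have "open (?T ` ?Q)"
    using lin open_surjective_linear_image by blast
  then have TQ: "?T ` ?Q \<in> sets borel" by simp
  have "emeasure lborel (?T ` ?Q) = emeasure (density (distr lborel borel ?T) (\<lambda>_. ?p)) (?T ` ?Q)"
    using lborel_affine_euclidean[of c 0] c by simp
  also have "\<dots> = ?p * emeasure lborel (?T -` (?T ` ?Q))"
    using TQ T by (simp add: emeasure_density nn_integral_cmult nn_integral_distr emeasure_distr)
  also have "?T -` (?T ` ?Q) = ?Q"
    using \<open>inj ?T\<close> by (rule inj_vimage_image_eq)
  finally have "measure lebesgue (?T ` ?Q) = ?p * measure lebesgue ?Q"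
    using TQ by (simp add: measure_def enn2real_mult prod_nonneg)
  then show ?thesis
    using content_ball_pos[of 1 "0::'a"] by (simp add: volume_factor_def)
qed

section \<open>Generating the invertible matrices\<close>

definition id_with_row :: "'n \<Rightarrow> 'f::field ^ 'n \<Rightarrow> 'f ^ 'n ^ 'n::finite" where
  "id_with_row j v = (\<chi> i. if i = j then v else axis i 1)"

lemma id_with_row_mult_vec:
  "(id_with_row j v *v x) $ i = (if i = j then \<Sum>k\<in>UNIV. v $ k * x $ k else x $ i)"
  by (cases "i = j") (simp_all add: id_with_row_def matrix_vector_mult_def axis_def mult_delta_left)

text \<open>
  Right multiplication adds to each row a multiple of the difference between the new row \<open>w\<close> and the
  unit row, so it leaves alone every row whose \<open>j\<close>-th entry is zero.
\<close>
lemma mult_id_with_row: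
  "(A ** id_with_row j w) $ k = A $ k + A $ k $ j *s (w - axis j 1)"
proof (subst vec_eq_iff, intro allI)
  fix l
  have "(A ** id_with_row j w) $ k $ l =
        (\<Sum>m\<in>UNIV. (if m = l then A $ k $ m else 0) +
                  (if m = j then A $ k $ m * (w $ l - axis j 1 $ l) else 0))"
    unfolding matrix_matrix_mult_def id_with_row_def
    by (auto simp: axis_def algebra_simps intro!: sum.cong)
  then show "(A ** id_with_row j w) $ k $ l = (A $ k + A $ k $ j *s (w - axis j 1)) $ l"
    by (simp add: sum.distrib algebra_simps)
qed

lemma id_with_row_mult:
  "id_with_row j v ** id_with_row j w = id_with_row j (v + v $ j *s (w - axis j 1))"
proof (subst vec_eq_iff, intro allI)
  fix k show "(id_with_row j v ** id_with_row j w) $ k = id_with_row j (v + v $ j *s (w - axis j 1)) $ k"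
    by (simp add: mult_id_with_row) (auto simp: id_with_row_def axis_def)
qed

lemma det_id_with_row:
  fixes v :: "'a::field ^ 'b::finite"
  shows "det (id_with_row j v) = v $ j"
proof -
  have "row i (mat 1 :: 'a ^ 'b ^ 'b) = axis i 1" for i
    by (auto simp: vec_eq_iff row_def mat_def axis_def)
  then show ?thesis
    using cramer_lemma_transpose[of j v "mat 1"] by (simp add: id_with_row_def basis_expansion cong: if_cong)
qed

text \<open>
  Gaussian elimination by column operations, measured by the number of rows that are not yet
  unit rows. If row \<open>i\<close> is not a unit row but its diagonal entry is nonzero, one multiplication from the right turns it into the
  unit row and keeps the unit rows already obtained. If the diagonal entry is zero, invertibility
  provides a nonzero entry of row \<open>i\<close> in some column \<open>j\<close> whose row is not yet a unit row, and adding
  column \<open>j\<close> to column \<open>i\<close> makes the diagonal entry nonzero, again without touching unit rows.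
\<close>
proposition invertible_matrix_induct_id_with_row [consumes 1, case_names id row_factor]:
  fixes A :: "'f::field ^ 'n ^ 'n::finite"
  assumes "det A \<noteq> 0"
    and id: "P (mat 1)"
    and row_factor: "\<And>B j v. det B \<noteq> 0 \<Longrightarrow> v $ j \<noteq> 0 \<Longrightarrow> P (B ** id_with_row j v) \<Longrightarrow> P B"
  shows "P A"
  using \<open>det A \<noteq> 0\<close>
proof (induction "card {i. A $ i \<noteq> axis i 1}" arbitrary: A rule: less_induct)
  case less
  have clear: "P B"
    if "det B \<noteq> 0" "B $ i $ i \<noteq> 0" "A $ i \<noteq> axis i 1"
      and good: "\<And>k. A $ k = axis k 1 \<Longrightarrow> B $ k = axis k 1" for B i
  proof -
    \<comment> \<open>The only \<open>w\<close> for which row \<open>i\<close> of the product is the unit row.\<close>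
    define w where "w = axis i 1 + inverse (B $ i $ i) *s (axis i 1 - B $ i)"
    let ?B = "B ** id_with_row i w"
    have w: "w $ i \<noteq> 0"
      using that by (simp add: w_def field_simps)
    have row_i: "?B $ i = axis i 1"
      using that by (simp add: mult_id_with_row w_def vec_eq_iff)
    have "?B $ k = axis k 1" if "A $ k = axis k 1" for k
      using good[OF that] \<open>A $ i \<noteq> axis i 1\<close> that
      by (auto simp: mult_id_with_row vec_eq_iff axis_def)
    then have "{k. ?B $ k \<noteq> axis k 1} \<subset> {k. A $ k \<noteq> axis k 1}"
      using row_i \<open>A $ i \<noteq> axis i 1\<close> by blast
    moreover have "det ?B \<noteq> 0"
      using w that by (simp add: det_mul det_id_with_row)
    ultimately have "P ?B"
      by (intro less.hyps psubset_card_mono) auto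
    then show "P B"
      using row_factor that w by blast
  qed
  show ?case
  proof (cases "\<forall>i. A $ i = axis i 1")
    case True
    then have "A = mat 1"
      by (simp add: vec_eq_iff mat_def axis_def)
    then show ?thesis using id by simp
  next
    case False
    then obtain i where i: "A $ i \<noteq> axis i 1" by blast
    \<comment> \<open>Otherwise row \<open>i\<close> is a combination of unit rows of \<open>A\<close> with itself as coefficient vector,
        so that \<open>A\<close> equals its product with a singular matrix.\<close>
    have "\<exists>j. A $ j \<noteq> axis j 1 \<and> A $ i $ j \<noteq> 0"
    proof (rule ccontr)
      assume "\<not> ?thesis"
      then have zero: "A $ i $ j = 0" if "A $ j \<noteq> axis j 1" for j
        using that by blast
      have "id_with_row i (A $ i) ** A = A"
      proof (simp only: vec_eq_iff, intro allI)
        fix k l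
        have "(\<Sum>m\<in>UNIV. A $ i $ m * A $ m $ l) = (\<Sum>m\<in>UNIV. A $ i $ m * axis m 1 $ l)"
          using zero by (intro sum.cong refl) (metis mult_zero_left)
        also have "\<dots> = A $ i $ l"
          by (simp add: axis_def mult_delta_right cong: if_cong)
        finally show "(id_with_row i (A $ i) ** A) $ k $ l = A $ k $ l"
          by (cases "k = i")
             (simp_all add: matrix_matrix_mult_def id_with_row_def axis_def mult_delta_left mult_delta_right cong: if_cong)
      qed
      then have "A $ i $ i * det A = det A"
        by (metis det_mul det_id_with_row)
      then show False
        using zero[OF i] less.prems by simp
    qed
    then obtain j where j: "A $ j \<noteq> axis j 1" "A $ i $ j \<noteq> 0" by blast
    show ?thesis
    proof (cases "A $ i $ i = 0")
      case False
      then show ?thesis using clear[of A i] i less.prems by blast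
    next
      case True
      then have "j \<noteq> i" using j by auto
      let ?v = "axis j 1 + axis i 1 :: 'f ^ 'n"
      have v: "?v $ j \<noteq> 0"
        using \<open>j \<noteq> i\<close> by (simp add: axis_def)
      have "P (A ** id_with_row j ?v)"
      proof (rule clear[of _ i])
        show "det (A ** id_with_row j ?v) \<noteq> 0"
          using v less.prems by (simp add: det_mul det_id_with_row)
        show "(A ** id_with_row j ?v) $ i $ i \<noteq> 0"
          using True j by (simp add: mult_id_with_row)
        show "(A ** id_with_row j ?v) $ k = axis k 1" if "A $ k = axis k 1" for k
          using that j by (auto simp: mult_id_with_row) (auto simp: axis_def vec_eq_iff)
      qed (rule i)
      then show ?thesis
        using row_factor[of A ?v j] v less.prems by blast
    qed
  qed
qed

section \<open>The volume factor of a matrix\<close>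

lemma linear_if_field_linear:
  fixes T :: "'f::{real_normed_field, euclidean_space} ^ 'n \<Rightarrow> 'f ^ 'n::finite"
  assumes "Vector_Spaces.linear (*s) (*s) T"
  shows "linear T"
proof -
  interpret T: Vector_Spaces.linear "(*s)" "(*s)" T by fact
  have "c *\<^sub>R x = of_real c *s x" for c and x :: "'f ^ 'n"
    by (simp add: vec_eq_iff scaleR_conv_of_real[where 'a = 'f])
  then show ?thesis
    by (auto intro!: linearI simp: T.add T.scale)
qed

lemma
  fixes A :: "'f::{real_normed_field, euclidean_space} ^ 'n ^ 'n::finite"
  shows linear_matrix_vector_mult: "linear ((*v) A)"
    and inj_matrix_vector_mult_if_det: "det A \<noteq> 0 \<Longrightarrow> inj ((*v) A)"
  by (auto intro: linear_if_field_linear matrix_vector_mul_linear_gen inj_matrix_vector_mult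
           simp: invertible_det_nz)

lemma volume_factor_matrix_mult:
  fixes A B :: "'f::{real_normed_field, euclidean_space} ^ 'n ^ 'n::finite"
  assumes "det A \<noteq> 0" "det B \<noteq> 0"
  shows "volume_factor ((*v) (A ** B)) = volume_factor ((*v) A) * volume_factor ((*v) B)"
proof -
  have "(*v) (A ** B) = (*v) A \<circ> (*v) B"
    by (simp add: fun_eq_iff matrix_vector_mul_assoc)
  then show ?thesis
    using assms by (simp add: volume_factor_compose linear_matrix_vector_mult inj_matrix_vector_mult_if_det)
qed

lemma volume_factor_unit_dilatation:
  fixes u :: "'f::{real_normed_field, euclidean_space}"
  assumes "norm u = 1"
  shows "volume_factor ((*v) (id_with_row j (u *s axis j 1) :: 'f ^ 'n ^ 'n::finite)) = 1"
proof (rule volume_factor_norm_preserving)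
  let ?E = "id_with_row j (u *s axis j 1) :: 'f ^ 'n ^ 'n"
  have "u \<noteq> 0" using assms by auto
  then show "surj ((*v) ?E)"
    by (intro linear_injective_imp_surjective linear_matrix_vector_mult inj_matrix_vector_mult_if_det)
       (simp_all add: det_id_with_row)
  show "norm (?E *v x) = norm x" for x
  proof -
    have "norm ((?E *v x) $ i) = norm (x $ i)" for i
      by (simp add: id_with_row_mult_vec axis_def mult_delta_left mult_delta_right norm_mult assms cong: if_cong)
    then show ?thesis
      by (simp add: norm_vec_def)
  qed
qed

text \<open>
  Multiplying one coordinate in \<open>'f\<close> by a real number stretches the \<open>DIM('f)\<close> real coordinates that it
  consists of, which is where the exponent of the final formula originates.
\<close>
lemma volume_factor_real_dilatation:
  assumes "r > 0"
  shows "volume_factor ((*v) (id_with_row j (of_real r *s axis j 1) ::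
           'f::{real_normed_field, euclidean_space} ^ 'n ^ 'n::finite)) = r ^ DIM('f)"
proof -
  let ?E = "id_with_row j (of_real r *s axis j 1) :: 'f ^ 'n ^ 'n"
  define c where "c b = (if b \<in> axis j ` (Basis :: 'f set) then r else 1)" for b :: "'f ^ 'n"
  have "(*v) ?E = (\<lambda>x. \<Sum>b\<in>Basis. (c b * (x \<bullet> b)) *\<^sub>R b)"
  proof (rule ext, rule euclidean_eqI)
    fix x b :: "'f ^ 'n" assume b: "b \<in> Basis"
    then obtain i d where id: "b = axis i d" "d \<in> Basis"
      by (auto simp: Basis_vec_def)
    then have "c b = (if i = j then r else 1)"
      by (auto simp: c_def axis_eq_axis)
    moreover have "(?E *v x) $ i = (if i = j then r *\<^sub>R x $ i else x $ i)"
      by (simp add: id_with_row_mult_vec axis_def mult_delta_left mult_delta_right scaleR_conv_of_real cong: if_cong)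
    moreover have "(\<Sum>b\<in>Basis. (c b * (x \<bullet> b)) *\<^sub>R b) \<bullet> b = c b * (x \<bullet> b)"
      using b by simp
    ultimately show "(?E *v x) \<bullet> b = (\<Sum>b\<in>Basis. (c b * (x \<bullet> b)) *\<^sub>R b) \<bullet> b"
      by (simp add: id inner_axis)
  qed
  then have "volume_factor ((*v) ?E) = (\<Prod>b\<in>Basis. \<bar>c b\<bar>)"
    using assms by (simp add: volume_factor_stretch c_def)
  also have "\<dots> = (\<Prod>b\<in>Basis. if b \<in> axis j ` (Basis :: 'f set) then r else 1)"
    using assms by (intro prod.cong) (auto simp: c_def)
  also have "\<dots> = (\<Prod>b \<in> Basis \<inter> axis j ` (Basis :: 'f set). r)"
    by (rule prod.inter_restrict[symmetric]) simp
  also have "Basis \<inter> axis j ` (Basis :: 'f set) = axis j ` Basis"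
    by (auto simp: Basis_vec_def)
  also have "(\<Prod>b \<in> axis j ` (Basis :: 'f set). r) = r ^ DIM('f)"
    by (simp add: card_image inj_on_def axis_eq_axis)
  finally show ?thesis .
qed

lemma volume_factor_dilatation:
  fixes a :: "'f::{real_normed_field, euclidean_space}"
  assumes "a \<noteq> 0"
  shows "volume_factor ((*v) (id_with_row j (a *s axis j 1) :: 'f ^ 'n ^ 'n::finite)) = norm a ^ DIM('f)"
proof -
  define u where "u = a / of_real (norm a)"
  have u: "norm u = 1" "a = of_real (norm a) * u" "u \<noteq> 0"
    using assms by (auto simp: u_def norm_divide)
  have "id_with_row j (a *s axis j 1) =
        (id_with_row j (of_real (norm a) *s axis j 1) ** id_with_row j (u *s axis j 1) :: 'f ^ 'n ^ 'n)"
    by (subst u(2)) (simp add: id_with_row_mult vec_eq_iff algebra_simps)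
  then show ?thesis
    using assms u volume_factor_real_dilatation[of "norm a" j] volume_factor_unit_dilatation[OF u(1), of j]
    by (simp add: volume_factor_matrix_mult det_id_with_row)
qed

text \<open>
  With diagonal entry \<open>a \<noteq> 1\<close>, the matrix is diagonalizable: a shear conjugates it to the
  coordinate dilatation by \<open>a\<close>. The unknown factor of the shear cancels because it is positive. For
  diagonal entry 1, composing with the dilatation by 2 gives a map with diagonal entry 2, of the
  same factor as the dilatation itself.
\<close>
lemma volume_factor_id_with_row:
  fixes v :: "'f::{real_normed_field, euclidean_space} ^ 'n::finite"
  assumes "v $ j \<noteq> 0"
  shows "volume_factor ((*v) (id_with_row j v)) = norm (v $ j) ^ DIM('f)"
proof -
  have pos: "volume_factor ((*v) (id_with_row j w)) > 0" if "w $ j \<noteq> 0" for w :: "'f ^ 'n"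
    using that
    by (intro linear_inj_scales_volumes linear_matrix_vector_mult inj_matrix_vector_mult_if_det)
       (simp add: det_id_with_row)
  have mult: "volume_factor ((*v) (id_with_row j w ** id_with_row j w')) =
              volume_factor ((*v) (id_with_row j w)) * volume_factor ((*v) (id_with_row j w'))"
    if "w $ j \<noteq> 0" "w' $ j \<noteq> 0" for w w' :: "'f ^ 'n"
    using that by (simp add: volume_factor_matrix_mult det_id_with_row)
  have neq_1: "volume_factor ((*v) (id_with_row j w)) = norm (w $ j) ^ DIM('f)"
    if w: "w $ j \<noteq> 0" "w $ j \<noteq> 1" for w :: "'f ^ 'n"
  proof -
    let ?a = "w $ j"
    \<comment> \<open>The row of the shear, determined by the conjugation identity proved next: \<open>k\<close> solves
        \<open>k = 1 + k * a\<close>, which is where \<open>a \<noteq> 1\<close> enters.\<close>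
    define k where "k = inverse (1 - ?a)"
    define s where "s = axis j 1 + k *s (w - ?a *s axis j 1)"
    have k: "k = 1 + k * ?a"
      using w by (simp add: k_def field_simps)
    have s: "s $ j = 1"
      by (simp add: s_def)
    have "w + ?a *s (s - axis j 1) = s + (?a *s axis j 1 - axis j 1)"
    proof (subst vec_eq_iff, intro allI)
      fix i
      let ?d = "w $ i - ?a * axis j 1 $ i"
      have "k * ?d = ?d + k * ?a * ?d"
        by (subst k) (simp add: algebra_simps)
      then show "(w + ?a *s (s - axis j 1)) $ i = (s + (?a *s axis j 1 - axis j 1)) $ i"
        by (simp add: s_def algebra_simps)
    qed
    then have "id_with_row j w ** id_with_row j s = id_with_row j s ** id_with_row j (?a *s axis j 1)"
      by (simp only: id_with_row_mult s vector_smult_lid)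
    then have "volume_factor ((*v) (id_with_row j w)) * volume_factor ((*v) (id_with_row j s)) =
               volume_factor ((*v) (id_with_row j s)) * volume_factor ((*v) (id_with_row j (?a *s axis j 1)))"
      using w s by (simp flip: mult)
    then show ?thesis
      using pos[of s] s w by (simp add: volume_factor_dilatation)
  qed
  show ?thesis
  proof (cases "v $ j = 1")
    case False
    then show ?thesis using neq_1 assms by blast
  next
    case True
    have "id_with_row j ((2::'f) *s axis j 1) ** id_with_row j v = id_with_row j (2 *s v)"
      by (simp add: id_with_row_mult vec_eq_iff algebra_simps)
    then have "volume_factor ((*v) (id_with_row j ((2::'f) *s axis j 1))) * volume_factor ((*v) (id_with_row j v)) =
               volume_factor ((*v) (id_with_row j (2 *s v)))"
      using mult[of "2 *s axis j 1" v] True by simp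
    then show ?thesis
      using True by (simp add: neq_1)
  qed
qed

lemma volume_factor_matrix:
  fixes A :: "'f::{real_normed_field, euclidean_space} ^ 'n ^ 'n::finite"
  assumes "det A \<noteq> 0"
  shows "volume_factor ((*v) A) = norm (det A) ^ DIM('f)"
  using assms
proof (induction A rule: invertible_matrix_induct_id_with_row)
  case id
  show ?case
    by (simp add: volume_factor_norm_preserving surj_def)
next
  case (row_factor B j v)
  then show ?case
    by (simp add: volume_factor_matrix_mult det_mul det_id_with_row volume_factor_id_with_row
                  norm_mult power_mult_distrib)
qed

theorem field_linear_scales_volumes:
  fixes T :: "'f::{real_normed_field, euclidean_space} ^ 'n \<Rightarrow> 'f ^ 'n::finite"
  assumes "Vector_Spaces.linear (*s) (*s) T"
  shows "scales_volumes T (norm (det (matrix T)) ^ DIM('f))"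
proof (cases "det (matrix T) = 0")
  case False
  have "T = (*v) (matrix T)"
    using matrix_works[OF assms] by auto
  then show ?thesis
    using False volume_factor_matrix[OF False] linear_inj_scales_volumes(1)[of T]
    by (metis linear_matrix_vector_mult inj_matrix_vector_mult_if_det)
next
  case True
  have "linear T" "\<not> inj T"
    using True assms by (simp_all add: linear_if_field_linear det_nz_iff_inj_gen[symmetric])
  then have "negligible (T ` E)" for E
    by (rule negligible_linear_singular_image)
  then show ?thesis
    using True by (auto simp: scales_volumes_def negligible_iff_null_sets null_setsD1 null_setsD2
                        simp del: emeasure_completion)
qed

theorem theorem2p5:
  shows "(\<forall>T :: real ^ 'n \<Rightarrow> real ^ 'n.
            Vector_Spaces.linear (*s) (*s) T \<longrightarrow>
              scales_volumes T \<bar>det (matrix T)\<bar>) \<and>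
         (\<forall>T :: complex ^ 'n \<Rightarrow> complex ^ 'n.
            Vector_Spaces.linear (*s) (*s) T \<longrightarrow>
              scales_volumes T ((cmod (det (matrix T)))\<^sup>2))"
  using field_linear_scales_volumes[where 'f = real and 'n = 'n]
        field_linear_scales_volumes[where 'f = complex and 'n = 'n]
  by simp

end
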